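(* The center of $U_q(\mathfrak g)$ is the unital $\mathbb K$-subalgebra generated by the element $$\Omega=qX+q^{-1}Y+(q-q^{-1})\theta Z.$$
   Context: $\mathbb K$ is an involutive extension of $\mathbb C$: an extension field of $\mathbb C$ equipped with an involutive automorphism restricting to complex conjugation on $\mathbb C$; an element is self-adjoint if it is fixed by the involution. $q\in\mathbb K^\times$ is not a root of unity and has self-adjoint square roots. $U_q(\mathfrak g)$ (the quantized enveloping algebra of $\mathfrak g=\mathfrak{sl}(2,\mathbb R)$) is the unital associative $\mathbb K$-algebra generated by $X,Y,Z,\theta$ subject to $XZ=q^2ZX$, $ZY=q^2YZ$, $XY+q^2Z^2=1$, $YX+q^{-2}Z^2=1$, $qX\theta-q^{-1}\theta X=q\theta Y-q^{-1}Y\theta=[2]_qZ$, $\theta Z-Z\theta=Y-X$, where $[2]_q=q+q^{-1}$. *)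

theory Defs
  imports
    Complex_Main
    "HOL-Library.Poly_Mapping"
    "HOL-Algebra.QuotRing"
    "HOL-Algebra.Subrings"
    "HOL-Algebra.Algebraic_Closure_Type"
begin

section \<open>Involutive extensions of the complex numbers\<close>

text \<open>A type \<open>'k\<close> of class field is an extension of the complex numbers by way of an
  embedding \<open>\<iota>\<close>; the involution is \<open>\<sigma>\<close> (bijective because \<open>\<sigma> (\<sigma> x) = x\<close>).\<close>

locale involutive_extension =
  fixes \<iota> :: "complex \<Rightarrow> 'k :: field" and \<sigma> :: "'k \<Rightarrow> 'k"
  assumes embed_add: "\<iota> (z + w) = \<iota> z + \<iota> w"
    and embed_mult: "\<iota> (z * w) = \<iota> z * \<iota> w"
    and embed_one: "\<iota> 1 = 1"
    and inv_add: "\<sigma> (x + y) = \<sigma> x + \<sigma> y"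
    and inv_mult: "\<sigma> (x * y) = \<sigma> x * \<sigma> y"
    and inv_inv: "\<sigma> (\<sigma> x) = x"
    and inv_embed: "\<sigma> (\<iota> z) = \<iota> (cnj z)"

definition self_adjoint :: "('k \<Rightarrow> 'k) \<Rightarrow> 'k \<Rightarrow> bool"
  where "self_adjoint \<sigma> x \<longleftrightarrow> \<sigma> x = x"


section \<open>The free algebra\<close>

text \<open>The free monoid, written additively so that finitely supported functions on it carry the
  convolution product of \<^theory>\<open>HOL-Library.Poly_Mapping\<close>. The type of lists itself is not
  used, to avoid a clash with the pointwise addition of lists in the library.\<close>

datatype 'a word = Word (letters: "'a list")

instantiation word :: (type) monoid_add
begin

definition zero_word :: "'a word" where "0 = Word []"

definition plus_word :: "'a word \<Rightarrow> 'a word \<Rightarrow> 'a word"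
  where "u + v = Word (letters u @ letters v)"

instance
  by standard (auto simp: zero_word_def plus_word_def)

end

datatype gen = X_gen | Y_gen | Z_gen | Theta_gen

type_synonym 'k free_alg = "gen word \<Rightarrow>\<^sub>0 'k"

definition generator :: "gen \<Rightarrow> 'k :: field free_alg"
  where "generator g = Poly_Mapping.single (Word [g]) 1"

definition scalar :: "'k :: field \<Rightarrow> 'k free_alg"
  where "scalar c = Poly_Mapping.single 0 c"


section \<open>The quantized enveloping algebra\<close>

definition relators :: "'k :: field \<Rightarrow> 'k free_alg set"
  where "relators q =
    (let x = generator X_gen; y = generator Y_gen; z = generator Z_gen; \<theta> = generator Theta_gen;
         two_q = q + inverse q
     in {x * z - scalar (q\<^sup>2) * z * x,
         z * y - scalar (q\<^sup>2) * y * z,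
         x * y + scalar (q\<^sup>2) * z\<^sup>2 - 1,
         y * x + scalar ((inverse q)\<^sup>2) * z\<^sup>2 - 1,
         scalar q * x * \<theta> - scalar (inverse q) * \<theta> * x - scalar two_q * z,
         scalar q * \<theta> * y - scalar (inverse q) * y * \<theta> - scalar two_q * z,
         \<theta> * z - z * \<theta> - (y - x)})"

definition rel_ideal :: "'k :: field \<Rightarrow> 'k free_alg set"
  where "rel_ideal q = genideal ring_of_type_algebra (relators q)"

definition Uq :: "'k :: field \<Rightarrow> 'k free_alg set ring"
  where "Uq q = ring_of_type_algebra Quot rel_ideal q"

definition Uq_class :: "'k :: field \<Rightarrow> 'k free_alg \<Rightarrow> 'k free_alg set"
  where "Uq_class q a = rel_ideal q +>\<^bsub>ring_of_type_algebra\<^esub> a"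

text \<open>The \<open>'k\<close>-algebra structure on \<^term>\<open>Uq q\<close> is the one given by this map.\<close>

definition Uq_scalar :: "'k :: field \<Rightarrow> 'k \<Rightarrow> 'k free_alg set"
  where "Uq_scalar q c = Uq_class q (scalar c)"

definition Omega :: "'k :: field \<Rightarrow> 'k free_alg set"
  where "Omega q =
    (let x = generator X_gen; y = generator Y_gen; z = generator Z_gen; \<theta> = generator Theta_gen
     in Uq_class q (scalar q * x + scalar (inverse q) * y + scalar (q - inverse q) * \<theta> * z))"


section \<open>Centre and generated subalgebras\<close>

definition ring_center :: "('a, 'b) ring_scheme \<Rightarrow> 'a set"
  where "ring_center R = {z \<in> carrier R. \<forall>x \<in> carrier R. z \<otimes>\<^bsub>R\<^esub> x = x \<otimes>\<^bsub>R\<^esub> z}"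

text \<open>Here \<open>\<kappa>\<close> is the structure map of the algebra \<open>R\<close>, so that \<open>c\<close> acts as multiplication
  by \<open>\<kappa> c\<close>. The locale \<^locale>\<open>subring\<close> includes the unit. The notion \<^locale>\<open>subalgebra\<close> of the
  library does not require closure under multiplication.\<close>

definition unital_subalgebra ::
    "('a, 'b) ring_scheme \<Rightarrow> ('k \<Rightarrow> 'a) \<Rightarrow> 'a set \<Rightarrow> bool"
  where "unital_subalgebra R \<kappa> V \<longleftrightarrow>
    subring V R \<and> (\<forall>c. \<forall>v \<in> V. \<kappa> c \<otimes>\<^bsub>R\<^esub> v \<in> V)"

definition generated_subalgebra ::
    "('a, 'b) ring_scheme \<Rightarrow> ('k \<Rightarrow> 'a) \<Rightarrow> 'a set \<Rightarrow> 'a set"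
  where "generated_subalgebra R \<kappa> S = unital_subalgebra R \<kappa> hull S"

end

theory Submission
  imports Defs
begin

text \<open>After inverting \<open>Z\<close>, the equation \<open>\<Omega> = q X + q\<inverse> Y + (q - q\<inverse>) \<theta> Z\<close> expresses \<open>\<theta>\<close>
through \<open>\<Omega>\<close>, \<open>X\<close>, \<open>Y\<close>, \<open>Z\<close>. After inverting \<open>X\<close> as well, the algebra becomes the quantum torus
\<open>X Z = q\<^sup>2 Z X\<close> over the polynomial ring \<open>K[\<Omega>]\<close>, whose centre is \<open>K[\<Omega>]\<close> because \<open>q\<close> is not a
root of unity. So the theorem follows once the algebra is known to embed into this torus.

The torus is seen here only through an action. It operates on the functions from the integers to
\<open>K[\<omega>]\<close>, where \<open>\<omega>\<close> is an indeterminate: \<open>X\<close> is the translation by one, \<open>Z\<close> multiplies the value at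
\<open>n\<close> by \<open>q\<close> to the power \<open>- 2 n\<close>, \<open>Y\<close> is the weighted backward shift that the product \<open>X Y\<close>
prescribes, and \<open>\<theta>\<close> is obtained by solving the equation above with \<open>\<Omega>\<close> acting as multiplication by
\<open>\<omega>\<close>. Lemma \<open>act_relators\<close> says that the defining relations hold.

The action is faithful (\<open>act_faithful\<close>) for two reasons. By the relations, every element is a
combination of the monomials \<open>\<theta>\<^sup>k X\<^sup>i Z\<^sup>j\<close> and \<open>\<theta>\<^sup>k Y\<^sup>i Z\<^sup>j\<close> (\<open>normalizable_all\<close>). And the operators of
these monomials are independent: \<open>\<theta>\<^sup>k\<close> raises the degree in \<open>\<omega>\<close> by exactly \<open>k\<close>, so that only the
monomials with the largest \<open>k\<close> contribute to the leading coefficient; of these, different powers of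
\<open>X\<close> and \<open>Y\<close> move a basis state to different positions; and the sum over \<open>j\<close> that remains is a
polynomial with infinitely many roots, namely all the eigenvalues of \<open>Z\<close>.

Let \<open>u\<close> be central. Its operator commutes with \<open>Z\<close>, whose eigenvalues on the basis states are
distinct, so it is diagonal; it commutes with the translation \<open>X\<close>, so its diagonal entries are one
and the same polynomial \<open>p\<close> in \<open>\<omega>\<close> (\<open>central_acts_by_scalar\<close>). The element \<open>p(\<Omega>)\<close> acts in the same
way, hence equals \<open>u\<close> by faithfulness. Faithfulness also makes \<open>\<Omega>\<close> central, since multiplication by
\<open>\<omega>\<close> commutes with every operator of the representation.\<close>

section \<open>Linear structure of the free algebra\<close>

lemma poly_mapping_induct_single [case_names zero add]:
  fixes P :: "('a \<Rightarrow>\<^sub>0 'b :: comm_monoid_add) \<Rightarrow> bool"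
  assumes "P 0" and "\<And>k c f. P f \<Longrightarrow> P (Poly_Mapping.single k c + f)"
  shows "P f"
proof -
  have eq: "f = (\<Sum>k\<in>Poly_Mapping.keys f. Poly_Mapping.single k (Poly_Mapping.lookup f k))"
    by (rule poly_mapping_eqI)
      (simp add: lookup_sum lookup_single when_def in_keys_iff)
  have "P (\<Sum>k\<in>A. Poly_Mapping.single k (Poly_Mapping.lookup f k))" if "finite A" for A
    using that by induction (simp_all add: assms)
  then show ?thesis by (subst eq) simp
qed

lemma scalar_commute: "scalar c * a = a * scalar c"
  by (induction a rule: poly_mapping_induct_single)
    (simp_all add: scalar_def distrib_left distrib_right mult_single mult.commute)

lemma scalar_simps:
  "scalar 0 = 0" "scalar 1 = 1" "scalar (c + d) = scalar c + scalar d"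
  "scalar (- c) = - scalar c" "scalar (c - d) = scalar c - scalar d"
  "scalar (c * d) = scalar c * scalar d"
  by (simp_all add: scalar_def single_add mult_single single_uminus single_diff)

lemma scalar_left_commute: "a * (scalar c * b) = scalar c * (a * b)"
  by (metis mult.assoc scalar_commute)

lemma scalar_scalar: "scalar c * (scalar d * a) = scalar (c * d) * a"
  by (simp add: scalar_simps mult.assoc)

section \<open>The defining ideal\<close>

lemma ring_of_type_algebra_simps:
  "carrier ring_of_type_algebra = UNIV"
  "a \<otimes>\<^bsub>ring_of_type_algebra\<^esub> b = a * b"
  "a \<oplus>\<^bsub>ring_of_type_algebra\<^esub> b = a + b"
  "\<one>\<^bsub>ring_of_type_algebra\<^esub> = 1"
  "\<zero>\<^bsub>ring_of_type_algebra\<^esub> = 0"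
  by (simp_all add: ring_of_type_algebra_def)

lemma ring_ring_of_type_algebra: "ring (ring_of_type_algebra :: 'a :: ring_1 ring)"
proof -
  have "\<exists>y. x + y = 0" "\<exists>y. y + x = 0" for x :: 'a
    using add.right_inverse add.left_inverse by blast+
  then show ?thesis
    by unfold_locales (auto simp: ring_of_type_algebra_simps algebra_simps Units_def)
qed

lemma a_inv_ring_of_type_algebra:
  "\<ominus>\<^bsub>ring_of_type_algebra\<^esub> (a :: 'a :: ring_1) = - a"
proof -
  interpret ring "ring_of_type_algebra :: 'a ring" by (rule ring_ring_of_type_algebra)
  show ?thesis
    by (rule minus_equality) (simp_all add: ring_of_type_algebra_simps)
qed

lemma ideal_ring_of_type_algebraI:
  fixes J :: "'a :: ring_1 set"
  assumes "0 \<in> J" "\<And>a b. a \<in> J \<Longrightarrow> b \<in> J \<Longrightarrow> a + b \<in> J" "\<And>a. a \<in> J \<Longrightarrow> - a \<in> J"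
    and "\<And>a x. a \<in> J \<Longrightarrow> x * a \<in> J" "\<And>a x. a \<in> J \<Longrightarrow> a * x \<in> J"
  shows "ideal J ring_of_type_algebra"
proof (rule idealI)
  interpret R: ring "ring_of_type_algebra :: 'a ring" by (rule ring_ring_of_type_algebra)
  show "ring (ring_of_type_algebra :: 'a ring)" by (rule ring_ring_of_type_algebra)
  show "subgroup J (add_monoid (ring_of_type_algebra :: 'a ring))"
    by (rule R.add.subgroupI)
      (use assms in \<open>auto simp: ring_of_type_algebra_simps simp flip: a_inv_def
        simp: a_inv_ring_of_type_algebra\<close>)
qed (use assms in \<open>auto simp: ring_of_type_algebra_simps\<close>)

lemma ideal_rel_ideal: "ideal (rel_ideal q) ring_of_type_algebra"
  unfolding rel_ideal_def
  by (rule ring.genideal_ideal[OF ring_ring_of_type_algebra]) (simp add: ring_of_type_algebra_simps)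

lemma rel_ideal_closed:
  shows rel_ideal_zero: "0 \<in> rel_ideal q"
    and rel_ideal_add: "a \<in> rel_ideal q \<Longrightarrow> b \<in> rel_ideal q \<Longrightarrow> a + b \<in> rel_ideal q"
    and rel_ideal_uminus: "a \<in> rel_ideal q \<Longrightarrow> - a \<in> rel_ideal q"
    and rel_ideal_mult_left: "a \<in> rel_ideal q \<Longrightarrow> x * a \<in> rel_ideal q"
    and rel_ideal_mult_right: "a \<in> rel_ideal q \<Longrightarrow> a * x \<in> rel_ideal q"
proof -
  interpret ideal "rel_ideal q" ring_of_type_algebra by (rule ideal_rel_ideal)
  show "0 \<in> rel_ideal q"
    using additive_subgroup.zero_closed[OF is_additive_subgroup] by (simp add: ring_of_type_algebra_simps)
  show "a \<in> rel_ideal q \<Longrightarrow> b \<in> rel_ideal q \<Longrightarrow> a + b \<in> rel_ideal q"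
    using additive_subgroup.a_closed[OF is_additive_subgroup, of a b] by (simp add: ring_of_type_algebra_simps)
  show "a \<in> rel_ideal q \<Longrightarrow> - a \<in> rel_ideal q"
    using additive_subgroup.a_inv_closed[OF is_additive_subgroup, of a] by (simp add: a_inv_ring_of_type_algebra)
  show "a \<in> rel_ideal q \<Longrightarrow> x * a \<in> rel_ideal q"
    using I_l_closed[of a x] by (simp add: ring_of_type_algebra_simps)
  show "a \<in> rel_ideal q \<Longrightarrow> a * x \<in> rel_ideal q"
    using I_r_closed[of a x] by (simp add: ring_of_type_algebra_simps)
qed

lemma relators_subset: "relators q \<subseteq> rel_ideal q"
  unfolding rel_ideal_def
  by (rule ring.genideal_self[OF ring_ring_of_type_algebra]) (simp add: ring_of_type_algebra_simps)

section \<open>A representation by weighted shifts\<close>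

text \<open>The indeterminate of the coefficient polynomials is the variable \<open>\<omega>\<close> by which \<open>\<Omega>\<close> acts.\<close>

type_synonym 'k state = "int \<Rightarrow> 'k poly"

locale generic_parameter =
  fixes q :: "'k :: field"
  assumes q_nonzero: "q \<noteq> 0"
    and q_power_neq_1: "n > 0 \<Longrightarrow> q ^ n \<noteq> 1"
begin

lemma q_powi_eq_1_iff: "q powi i = 1 \<longleftrightarrow> i = 0"
proof (cases "i \<ge> 0")
  case True
  then show ?thesis using q_power_neq_1[of "nat i"] by (cases "i = 0") (auto simp: power_int_def)
next
  case False
  then show ?thesis using q_power_neq_1[of "nat (- i)"]
    by (auto simp: power_int_def power_inverse)
qed

lemma q_square: "q\<^sup>2 \<noteq> 1"
  using q_power_neq_1[of 2] by simp

abbreviation gX where "gX \<equiv> generator X_gen :: 'k free_alg"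
abbreviation gY where "gY \<equiv> generator Y_gen :: 'k free_alg"
abbreviation gZ where "gZ \<equiv> generator Z_gen :: 'k free_alg"
abbreviation g\<theta> where "g\<theta> \<equiv> generator Theta_gen :: 'k free_alg"

definition weight :: "int \<Rightarrow> 'k"
  where "weight n = q powi (- 2 * n)"

lemma weight_nonzero [simp]: "weight n \<noteq> 0"
  by (simp add: weight_def q_nonzero)

lemma weight_shift: "weight (n + 1) = weight n / q\<^sup>2" "weight (n - 1) = q\<^sup>2 * weight n"
proof -
  have *: "q powi 2 = q\<^sup>2" by (simp add: power_int_def)
  have "weight (n + 1) = q powi (- 2 * n - 2)"
    unfolding weight_def by (rule arg_cong[where f = "(powi) q"]) simp
  also have "\<dots> = weight n / q powi 2"
    unfolding weight_def by (rule power_int_diff) (use q_nonzero in simp)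
  finally show "weight (n + 1) = weight n / q\<^sup>2" by (simp only: *)
  have "weight (n - 1) = q powi (2 + (- 2 * n))"
    unfolding weight_def by (rule arg_cong[where f = "(powi) q"]) simp
  also have "\<dots> = q powi 2 * weight n"
    unfolding weight_def by (rule power_int_add) (use q_nonzero in simp)
  finally show "weight (n - 1) = q\<^sup>2 * weight n" by (simp only: *)
qed

lemma inj_weight: "inj weight"
proof
  fix m n assume "weight m = weight n"
  moreover have "q powi (- 2 * m - (- 2 * n)) = weight m / weight n"
    unfolding weight_def by (rule power_int_diff) (use q_nonzero in simp)
  ultimately show "m = n" using q_powi_eq_1_iff[of "- 2 * m - (- 2 * n)"] by simp
qed

text \<open>The factor in \<open>Y \<delta>\<^sub>n = lowering n \<cdot> \<delta>\<^sub>n\<^sub>-\<^sub>1\<close> on the basis state at \<open>n\<close>, forced by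
\<open>X Y = 1 - q\<^sup>2 Z\<^sup>2\<close> because \<open>X\<close> translates \<open>\<delta>\<^sub>n\<^sub>-\<^sub>1\<close> back to \<open>\<delta>\<^sub>n\<close>.\<close>

definition lowering :: "int \<Rightarrow> 'k"
  where "lowering n = 1 - q\<^sup>2 * (weight n)\<^sup>2"

text \<open>The factor is \<open>1\<close> minus a power of \<open>q\<close> with exponent \<open>2 - 4 n\<close>, which is never zero. This is why the
eigenvalues of \<open>Z\<close> are the even powers of \<open>q\<close>: with odd powers the factor would vanish at one \<open>n\<close>,
and the powers of \<open>Y\<close> would not act injectively.\<close>

lemma lowering_nonzero: "lowering n \<noteq> 0"
proof -
  have "q powi (2 + (- 2 * n + - 2 * n)) = q powi 2 * (weight n * weight n)"
    unfolding weight_def using q_nonzero by (subst power_int_add, simp, subst power_int_add) simp_all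
  moreover have "2 + (- 2 * n + - 2 * n) \<noteq> 0" by presburger
  ultimately show ?thesis
    using q_powi_eq_1_iff[of "2 + (- 2 * n + - 2 * n)"]
    by (simp add: lowering_def power2_eq_square power_int_def numeral_2_eq_2)
qed

text \<open>The scalar \<open>1 / (q - q\<inverse>)\<close> that appears when the equation for \<open>\<Omega>\<close> is solved for \<open>\<theta>\<close>.\<close>

definition theta_scale :: 'k
  where "theta_scale = inverse (q - inverse q)"

lemma theta_scale_nonzero: "theta_scale \<noteq> 0"
  using q_nonzero q_square by (auto simp: theta_scale_def power2_eq_square field_simps)

lemma theta_scale_eq: "q * q * theta_scale = q + theta_scale"
  using q_nonzero q_square by (simp add: theta_scale_def power2_eq_square field_simps)

text \<open>The last equation is \<open>\<theta> = (\<omega> - q X - q\<inverse> Y) Z\<inverse> / (q - q\<inverse>)\<close>; prefixing the coefficient \<open>0\<close> is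
multiplication by \<open>\<omega>\<close>.\<close>

fun gen_act :: "gen \<Rightarrow> 'k state \<Rightarrow> 'k state"
  where
    "gen_act X_gen v n = v (n - 1)"
  | "gen_act Y_gen v n = smult (lowering (n + 1)) (v (n + 1))"
  | "gen_act Z_gen v n = smult (weight n) (v n)"
  | "gen_act Theta_gen v n = smult theta_scale
       (pCons 0 (smult (inverse (weight n)) (v n))
        - smult (q / weight (n - 1)) (v (n - 1))
        - smult (inverse q * lowering (n + 1) / weight (n + 1)) (v (n + 1)))"

definition word_act :: "gen word \<Rightarrow> 'k state \<Rightarrow> 'k state"
  where "word_act w = foldr gen_act (letters w)"

definition act :: "'k free_alg \<Rightarrow> 'k state \<Rightarrow> 'k state"
  where "act a v n = (\<Sum>w\<in>Poly_Mapping.keys a. smult (Poly_Mapping.lookup a w) (word_act w v n))"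

lemma act_add: "act (a + b) v n = act a v n + act b v n"
  unfolding act_def
  by (rule setsum_keys_plus_distrib) (simp_all add: smult_add_left)

lemma act_zero: "act 0 v n = 0"
  by (simp add: act_def)

lemma act_uminus: "act (- a) v n = - act a v n"
  using act_add[of a "- a" v n] by (simp add: act_zero eq_neg_iff_add_eq_0 add.commute)

lemma act_diff: "act (a - b) v n = act a v n - act b v n"
  using act_add[of a "- b" v n] by (simp add: act_uminus)

lemma act_single: "act (Poly_Mapping.single w c) v n = smult c (word_act w v n)"
  by (simp add: act_def)

lemma act_sum: "act (\<Sum>i\<in>A. f i) v n = (\<Sum>i\<in>A. act (f i) v n)"
  by (induction A rule: infinite_finite_induct) (simp_all add: act_zero act_add)

lemma gen_act_add: "gen_act g (\<lambda>n. u n + v n) = (\<lambda>n. gen_act g u n + gen_act g v n)"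
  by (cases g; rule ext) (simp_all add: smult_add_right smult_diff_right algebra_simps)

lemma gen_act_mult: "gen_act g (\<lambda>n. p * v n) = (\<lambda>n. p * gen_act g v n)"
  by (cases g; rule ext) (simp_all add: algebra_simps)

lemma word_act_add: "word_act w (\<lambda>n. u n + v n) = (\<lambda>n. word_act w u n + word_act w v n)"
proof -
  have "foldr gen_act gs (\<lambda>n. u n + v n) = (\<lambda>n. foldr gen_act gs u n + foldr gen_act gs v n)" for gs
    by (induction gs) (simp_all add: gen_act_add)
  then show ?thesis by (simp add: word_act_def)
qed

lemma word_act_mult: "word_act w (\<lambda>n. p * v n) = (\<lambda>n. p * word_act w v n)"
proof -
  have "foldr gen_act gs (\<lambda>n. p * v n) = (\<lambda>n. p * foldr gen_act gs v n)" for gs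
    by (induction gs) (simp_all add: gen_act_mult)
  then show ?thesis by (simp add: word_act_def)
qed

lemma act_state_mult: "act a (\<lambda>n. p * v n) = (\<lambda>n. p * act a v n)"
  by (rule ext) (simp add: act_def word_act_mult sum_distrib_left)

lemma act_state_zero: "act a (\<lambda>n. 0) = (\<lambda>n. 0)"
  using act_state_mult[of a 0 "\<lambda>n. 0"] by simp

lemma word_act_smult: "word_act w (\<lambda>n. smult c (v n)) = (\<lambda>n. smult c (word_act w v n))"
  using word_act_mult[of w "[:c:]" v] by simp

lemma act_mult: "act (a * b) v = act a (act b v)"
proof -
  have *: "act (Poly_Mapping.single w c * b) v = (\<lambda>n. smult c (word_act w (act b v) n))" for w c
  proof (induction b rule: poly_mapping_induct_single)
    case zero
    have "word_act w (\<lambda>n. 0) = (\<lambda>n. 0)"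
      using word_act_mult[of w 0 "\<lambda>n. 0"] by simp
    then show ?case by (simp add: act_zero [abs_def])
  next
    case (add k d f)
    have "act (Poly_Mapping.single k d + f) v = (\<lambda>n. smult d (word_act k v n) + act f v n)"
      by (rule ext) (simp add: act_add act_single)
    moreover have "word_act (w + k) v = word_act w (word_act k v)"
      by (simp add: word_act_def plus_word_def)
    ultimately show ?case
      by (intro ext) (simp add: distrib_left act_add mult_single act_single add word_act_add
          word_act_smult smult_add_right)
  qed
  show ?thesis
    by (induction a rule: poly_mapping_induct_single)
      (auto simp: fun_eq_iff act_zero distrib_right act_add * act_single)
qed

lemma act_scalar: "act (scalar c) v n = smult c (v n)"
  by (simp add: scalar_def act_single word_act_def zero_word_def)

lemma act_one: "act 1 v = v"
  using act_scalar[of 1 v] by (simp add: fun_eq_iff scalar_simps)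

lemma act_generator: "act (generator g) v = gen_act g v"
  by (rule ext) (simp add: generator_def act_single word_act_def)

lemmas act_simps = act_add act_diff act_mult act_scalar act_one act_generator

text \<open>The first four relations hold by the choice of weights. In the two relations between \<open>\<theta>\<close> and \<open>X\<close> or
\<open>Y\<close>, the terms with \<open>\<omega>\<close>, \<open>X\<^sup>2\<close> and \<open>Y\<^sup>2\<close> cancel and \<open>(Y X - X Y) Z\<inverse> = (q\<^sup>2 - q\<^sup>-\<^sup>2) Z\<close> is left, which
is \<open>q - q\<inverse>\<close> times \<open>(q + q\<inverse>) Z\<close>. In the last relation only the terms with \<open>X\<close> and \<open>Y\<close> survive,
each with the factor \<open>q - q\<inverse>\<close>. So \<open>theta_scale\<close> is the right normalization in all three.\<close>

lemma act_relators:
  assumes "r \<in> relators q"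
  shows "act r v n = 0"
proof -
  have [simp]: "q \<noteq> 0" by (rule q_nonzero)
  have s: "weight (n + 2) = weight n / (q\<^sup>2 * q\<^sup>2)" "weight (n - 2) = q\<^sup>2 * q\<^sup>2 * weight n"
  proof -
    have "weight (n + 2) = weight (n + 1 + 1)" "weight (n - 2) = weight (n - 1 - 1)"
      by (simp_all add: add.commute)
    then show "weight (n + 2) = weight n / (q\<^sup>2 * q\<^sup>2)" "weight (n - 2) = q\<^sup>2 * q\<^sup>2 * weight n"
      by (simp_all only: weight_shift) simp_all
  qed
  note coeffs = weight_shift weight_shift(1)[of n, unfolded add.commute[of n]]
    s s[unfolded add.commute[of n]] lowering_def
  have r1: "Polynomial.coeff (act (gX * gZ - scalar (q\<^sup>2) * gZ * gX) v n) m = 0" for m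
    by (cases m) (simp_all add: act_simps coeffs divide_simps power2_eq_square algebra_simps)
  have r2: "Polynomial.coeff (act (gZ * gY - scalar (q\<^sup>2) * gY * gZ) v n) m = 0" for m
    by (cases m) (simp_all add: act_simps coeffs divide_simps power2_eq_square algebra_simps)
  have r3: "Polynomial.coeff (act (gX * gY + scalar (q\<^sup>2) * (gZ)\<^sup>2 - 1) v n) m = 0" for m
    by (cases m) (simp_all add: act_simps coeffs divide_simps power2_eq_square algebra_simps)
  have r4: "Polynomial.coeff (act (gY * gX + scalar ((inverse q)\<^sup>2) * (gZ)\<^sup>2 - 1) v n) m = 0" for m
    by (cases m) (simp_all add: act_simps coeffs divide_simps power2_eq_square algebra_simps)
  \<comment> \<open>\<open>(q\<^sup>2 - 1) theta_scale = q\<close>, as rewrite rules that eliminate \<open>q\<^sup>2\<close> next to \<open>theta_scale\<close>.\<close>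
  have d: "q * (q * theta_scale) = q + theta_scale"
    "q * (q * (theta_scale * x)) = q * x + theta_scale * x" for x
    using theta_scale_eq by (simp_all flip: mult.assoc distrib_right)
  have r5: "Polynomial.coeff (act (scalar q * gX * g\<theta> - scalar (inverse q) * g\<theta> * gX
      - scalar (q + inverse q) * gZ) v n) m = 0" for m
    by (cases m) (simp_all add: act_simps coeffs divide_simps power2_eq_square,
        simp_all add: algebra_simps d)
  have r6: "Polynomial.coeff (act (scalar q * g\<theta> * gY - scalar (inverse q) * gY * g\<theta>
      - scalar (q + inverse q) * gZ) v n) m = 0" for m
    by (cases m) (simp_all add: act_simps coeffs divide_simps power2_eq_square,
        simp_all add: algebra_simps d)
  have r7: "Polynomial.coeff (act (g\<theta> * gZ - gZ * g\<theta> - (gY - gX)) v n) m = 0" for m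
    by (cases m) (simp_all add: act_simps coeffs divide_simps power2_eq_square,
        simp_all add: algebra_simps d)
  have "Polynomial.coeff (act r v n) m = 0" for m
    using assms r1 r2 r3 r4 r5 r6 r7 unfolding relators_def Let_def by blast
  then show ?thesis by (simp add: poly_eq_iff)
qed

lemma act_rel_ideal:
  assumes "a \<in> rel_ideal q"
  shows "act a v n = 0"
proof -
  have "ideal {a. \<forall>v n. act a v n = 0} ring_of_type_algebra"
  proof (rule ideal_ring_of_type_algebraI; clarsimp)
    fix a x v n assume "\<forall>v n. act a v n = 0"
    then have "act a v = (\<lambda>n. 0)" for v by auto
    then show "act (x * a) v n = 0" by (simp add: act_mult act_state_zero)
  qed (simp_all add: act_zero act_add act_uminus act_mult)
  then have "rel_ideal q \<subseteq> {a. \<forall>v n. act a v n = 0}"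
    unfolding rel_ideal_def
    by (rule ring.genideal_minimal[OF ring_ring_of_type_algebra]) (auto simp: act_relators)
  with assms show ?thesis by auto
qed

section \<open>Spanning monomials\<close>

definition cong :: "'k free_alg \<Rightarrow> 'k free_alg \<Rightarrow> bool" (infix "\<asymp>" 50)
  where "a \<asymp> b \<longleftrightarrow> a - b \<in> rel_ideal q"

lemma cong_refl: "a \<asymp> a"
  by (simp add: cong_def rel_ideal_zero)

lemma cong_sym: "a \<asymp> b \<Longrightarrow> b \<asymp> a"
  using rel_ideal_uminus[of "a - b" q] by (simp add: cong_def)

lemma cong_trans [trans]: "a \<asymp> b \<Longrightarrow> b \<asymp> c \<Longrightarrow> a \<asymp> c"
  using rel_ideal_add[of "a - b" q "b - c"] by (simp add: cong_def)

lemma cong_add: "a \<asymp> b \<Longrightarrow> c \<asymp> d \<Longrightarrow> a + c \<asymp> b + d"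
  using rel_ideal_add[of "a - b" q "c - d"] by (simp add: cong_def algebra_simps)

lemma cong_mult_left: "a \<asymp> b \<Longrightarrow> x * a \<asymp> x * b"
  using rel_ideal_mult_left[of "a - b" q x] by (simp add: cong_def algebra_simps)

lemma cong_mult_right: "a \<asymp> b \<Longrightarrow> a * x \<asymp> b * x"
  using rel_ideal_mult_right[of "a - b" q x] by (simp add: cong_def algebra_simps)

lemma act_cong: "a \<asymp> b \<Longrightarrow> act a v = act b v"
  using act_rel_ideal[of "a - b" v] by (auto simp: cong_def act_diff fun_eq_iff)

lemma cong_scalar_cancel:
  assumes "scalar c * a \<asymp> b" "c \<noteq> 0"
  shows "a \<asymp> scalar (inverse c) * b"
  using cong_mult_left[OF assms(1), of "scalar (inverse c)"] assms(2)
  by (simp add: scalar_scalar scalar_simps)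

lemma relations:
  shows rel_XZ: "gX * gZ \<asymp> scalar (q\<^sup>2) * (gZ * gX)"
    and rel_ZY: "gZ * gY \<asymp> scalar (q\<^sup>2) * (gY * gZ)"
    and rel_XY: "gX * gY \<asymp> 1 - scalar (q\<^sup>2) * gZ\<^sup>2"
    and rel_YX: "gY * gX \<asymp> 1 - scalar ((inverse q)\<^sup>2) * gZ\<^sup>2"
    and rel_XT_scaled: "scalar q * (gX * g\<theta>) \<asymp> scalar (inverse q) * (g\<theta> * gX) + scalar (q + inverse q) * gZ"
    and rel_YT_scaled: "scalar (inverse q) * (gY * g\<theta>) \<asymp> scalar q * (g\<theta> * gY) - scalar (q + inverse q) * gZ"
    and rel_ZT: "gZ * g\<theta> \<asymp> g\<theta> * gZ - gY + gX"
proof -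
  note r = relators_subset[of q, unfolded relators_def Let_def, THEN subsetD]
  show "gX * gZ \<asymp> scalar (q\<^sup>2) * (gZ * gX)" "gZ * gY \<asymp> scalar (q\<^sup>2) * (gY * gZ)"
    "gX * gY \<asymp> 1 - scalar (q\<^sup>2) * gZ\<^sup>2" "gY * gX \<asymp> 1 - scalar ((inverse q)\<^sup>2) * gZ\<^sup>2"
    "scalar q * (gX * g\<theta>) \<asymp> scalar (inverse q) * (g\<theta> * gX) + scalar (q + inverse q) * gZ"
    unfolding cong_def by (rule r; simp add: mult.assoc algebra_simps)+
  have "scalar (inverse q) * (gY * g\<theta>) - (scalar q * (g\<theta> * gY) - scalar (q + inverse q) * gZ) =
    - (scalar q * g\<theta> * gY - scalar (inverse q) * gY * g\<theta> - scalar (q + inverse q) * gZ)"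
    by (simp add: algebra_simps)
  then show "scalar (inverse q) * (gY * g\<theta>) \<asymp> scalar q * (g\<theta> * gY) - scalar (q + inverse q) * gZ"
    unfolding cong_def by (simp only:) (rule rel_ideal_uminus, rule r, simp)
  have "gZ * g\<theta> - (g\<theta> * gZ - gY + gX) = - (g\<theta> * gZ - gZ * g\<theta> - (gY - gX))"
    by (simp add: algebra_simps)
  then show "gZ * g\<theta> \<asymp> g\<theta> * gZ - gY + gX"
    unfolding cong_def by (simp only:) (rule rel_ideal_uminus, rule r, simp)
qed

lemma rel_ZX: "gZ * gX \<asymp> scalar (inverse (q\<^sup>2)) * (gX * gZ)"
  by (rule cong_scalar_cancel[OF cong_sym[OF rel_XZ]]) (simp add: q_nonzero)

lemma rel_XT:
  "gX * g\<theta> \<asymp> scalar (inverse q) *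
    (scalar (inverse q) * (g\<theta> * gX) + scalar (q + inverse q) * gZ)"
  by (rule cong_scalar_cancel[OF rel_XT_scaled]) (simp add: q_nonzero)

lemma rel_YT: "gY * g\<theta> \<asymp> scalar q * (scalar q * (g\<theta> * gY) - scalar (q + inverse q) * gZ)"
  using cong_scalar_cancel[OF rel_YT_scaled] by (simp add: q_nonzero)

lemma q_commute_power:
  assumes "a * b \<asymp> scalar c * (b * a)"
  shows "a * b ^ n \<asymp> scalar (c ^ n) * (b ^ n * a)"
proof (induction n)
  case 0
  show ?case by (simp add: cong_refl scalar_simps)
next
  case (Suc n)
  have "a * b ^ Suc n \<asymp> scalar c * (b * a) * b ^ n"
    using cong_mult_right[OF assms, of "b ^ n"] by (simp add: mult.assoc)
  also have "\<dots> = scalar c * b * (a * b ^ n)" by (simp add: mult.assoc)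
  also have "\<dots> \<asymp> scalar c * b * (scalar (c ^ n) * (b ^ n * a))"
    by (rule cong_mult_left) (rule Suc)
  also have "\<dots> = scalar (c ^ Suc n) * (b ^ Suc n * a)"
    by (simp add: mult.assoc scalar_left_commute[of b] scalar_scalar)
  finally show ?case .
qed

text \<open>One integer exponent covers the powers of both \<open>X\<close> and \<open>Y\<close>: it is the displacement by which the
element moves a basis state.\<close>

definition xy_power :: "int \<Rightarrow> 'k free_alg"
  where "xy_power i = (if i \<ge> 0 then gX ^ nat i else gY ^ nat (- i))"

lemma X_xy_power: "i \<ge> 0 \<Longrightarrow> gX * xy_power i = xy_power (i + 1)"
  by (simp add: xy_power_def nat_add_distrib flip: power_Suc)

lemma Y_xy_power: "i \<le> 0 \<Longrightarrow> gY * xy_power i = xy_power (i - 1)"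
proof -
  assume "i \<le> 0"
  then have "nat (1 - i) = Suc (nat (- i))" by simp
  then show ?thesis using \<open>i \<le> 0\<close> by (cases "i = 0") (auto simp: xy_power_def)
qed

fun monomial :: "nat \<times> int \<times> nat \<Rightarrow> 'k free_alg"
  where "monomial (k, i, j) = g\<theta> ^ k * (xy_power i * gZ ^ j)"

declare monomial.simps [simp del]

definition combination :: "(nat \<times> int \<times> nat \<Rightarrow>\<^sub>0 'k) \<Rightarrow> 'k free_alg"
  where "combination f = (\<Sum>t\<in>Poly_Mapping.keys f. scalar (Poly_Mapping.lookup f t) * monomial t)"

lemma combination_add: "combination (f + g) = combination f + combination g"
  unfolding combination_def
  by (rule setsum_keys_plus_distrib) (simp_all add: scalar_simps distrib_right)

lemma combination_single: "combination (Poly_Mapping.single t c) = scalar c * monomial t"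
  by (simp add: combination_def scalar_simps)

lemma combination_zero: "combination 0 = 0"
  by (simp add: combination_def)

lemma scalar_combination: "\<exists>g. scalar c * combination f = combination g"
proof (induction f rule: poly_mapping_induct_single)
  case zero
  have "scalar c * combination 0 = combination 0" by (simp add: combination_zero)
  then show ?case by (rule exI)
next
  case (add t d f)
  then obtain g where "scalar c * combination f = combination g" ..
  then have "scalar c * combination (Poly_Mapping.single t d + f)
      = combination (Poly_Mapping.single t (c * d) + g)"
    by (simp add: combination_add combination_single distrib_left scalar_scalar)
  then show ?case by (rule exI)
qed

definition normalizable :: "'k free_alg \<Rightarrow> bool"
  where "normalizable a \<longleftrightarrow> (\<exists>f. a \<asymp> combination f)"

lemma normalizable_cong: "a \<asymp> b \<Longrightarrow> normalizable b \<Longrightarrow> normalizable a"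
  unfolding normalizable_def using cong_trans by blast

lemma normalizable_zero: "normalizable 0"
  using cong_refl[of "combination 0"] unfolding normalizable_def combination_zero[symmetric] by (rule exI)

lemma normalizable_add: "normalizable a \<Longrightarrow> normalizable b \<Longrightarrow> normalizable (a + b)"
  unfolding normalizable_def by (elim exE, rule exI, subst combination_add, rule cong_add)

lemma normalizable_scalar:
  assumes "normalizable a"
  shows "normalizable (scalar c * a)"
proof -
  obtain f where "a \<asymp> combination f" using assms unfolding normalizable_def ..
  moreover obtain g where "scalar c * combination f = combination g"
    using scalar_combination[of c f] ..
  ultimately have "scalar c * a \<asymp> combination g"
    using cong_mult_left[of a "combination f" "scalar c"] by simp
  then show ?thesis unfolding normalizable_def by (rule exI)
qed

lemma normalizable_diff: "normalizable a \<Longrightarrow> normalizable b \<Longrightarrow> normalizable (a - b)"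
  using normalizable_add[of a "scalar (- 1) * b"] normalizable_scalar[of b "- 1"] by (simp add: scalar_simps)

lemma normalizable_monomial: "normalizable (monomial t)"
  unfolding normalizable_def
  by (rule exI[of _ "Poly_Mapping.single t 1"])
    (simp only: combination_single scalar_simps mult_1 cong_refl)

lemma normalizable_mult_left:
  assumes "\<And>t. normalizable (a * monomial t)" and "normalizable b"
  shows "normalizable (a * b)"
proof -
  have "normalizable (a * combination f)" for f
  proof (induction f rule: poly_mapping_induct_single)
    case zero
    show ?case by (simp add: combination_zero normalizable_zero)
  next
    case (add t c f)
    then show ?case
      by (simp add: combination_add combination_single distrib_left scalar_left_commute[of a]
          normalizable_add normalizable_scalar assms(1))
  qed
  then show ?thesis
    using assms(2) unfolding normalizable_def[of b] by (elim exE) (rule normalizable_cong[OF cong_mult_left])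
qed

lemma Z_monomial: "\<exists>c. gZ * monomial (0, i, j) \<asymp> scalar c * monomial (0, i, Suc j)"
proof -
  have "\<exists>c. gZ * xy_power i \<asymp> scalar c * (xy_power i * gZ)"
    using q_commute_power[OF rel_ZX] q_commute_power[OF rel_ZY]
    unfolding xy_power_def by (cases "i \<ge> 0") auto
  then obtain c where "gZ * xy_power i \<asymp> scalar c * (xy_power i * gZ)" ..
  then have "gZ * xy_power i * gZ ^ j \<asymp> scalar c * (xy_power i * gZ) * gZ ^ j"
    by (rule cong_mult_right)
  then have "gZ * monomial (0, i, j) \<asymp> scalar c * monomial (0, i, Suc j)"
    by (simp only: mult.assoc monomial.simps power_0 power_Suc mult_1)
  then show ?thesis by (rule exI)
qed

lemma normalizable_theta: "normalizable a \<Longrightarrow> normalizable (g\<theta> * a)"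
proof (rule normalizable_mult_left)
  fix t :: "nat \<times> int \<times> nat"
  obtain k i j where t: "t = (k, i, j)" by (cases t)
  have "g\<theta> * monomial t = monomial (Suc k, i, j)" by (simp add: t monomial.simps mult.assoc)
  then show "normalizable (g\<theta> * monomial t)" by (simp only: normalizable_monomial)
qed

lemma normalizable_Z_base: "normalizable (gZ * monomial (0, i, j))"
proof -
  obtain c where "gZ * monomial (0, i, j) \<asymp> scalar c * monomial (0, i, Suc j)"
    using Z_monomial[of i j] ..
  then show ?thesis by (rule normalizable_cong) (intro normalizable_scalar normalizable_monomial)
qed

lemma normalizable_Z2_base: "normalizable (gZ\<^sup>2 * monomial (0, i, j))"
proof -
  obtain c where "gZ * monomial (0, i, j) \<asymp> scalar c * monomial (0, i, Suc j)"
    using Z_monomial[of i j] ..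
  from cong_mult_left[OF this, of gZ]
  have "gZ\<^sup>2 * monomial (0, i, j) \<asymp> scalar c * (gZ * monomial (0, i, Suc j))"
    by (simp only: power2_eq_square mult.assoc scalar_left_commute[of gZ])
  then show ?thesis by (rule normalizable_cong) (intro normalizable_scalar normalizable_Z_base)
qed

text \<open>Both products of \<open>X\<close> and \<open>Y\<close> are polynomials in \<open>Z\<close>, so that a word without \<open>\<theta>\<close> never needs \<open>X\<close> and
\<open>Y\<close> together.\<close>

lemma normalizable_XY_base:
  assumes "a * b \<asymp> 1 - scalar c * gZ\<^sup>2"
  shows "normalizable (a * (b * monomial (0, i, j)))"
proof -
  have "a * (b * monomial (0, i, j)) \<asymp> monomial (0, i, j) - scalar c * (gZ\<^sup>2 * monomial (0, i, j))"
    using cong_mult_right[OF assms, of "monomial (0, i, j)"]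
    by (simp only: mult.assoc left_diff_distrib mult_1)
  then show ?thesis
    by (rule normalizable_cong)
      (intro normalizable_diff normalizable_scalar normalizable_monomial normalizable_Z2_base)
qed

lemma normalizable_X_base: "normalizable (gX * monomial (0, i, j))"
proof (cases "i \<ge> 0")
  case True
  then have "gX * monomial (0, i, j) = monomial (0, i + 1, j)"
    by (simp add: monomial.simps flip: mult.assoc X_xy_power)
  then show ?thesis by (simp only: normalizable_monomial)
next
  case False
  then have "monomial (0, i, j) = gY * monomial (0, i + 1, j)"
    using Y_xy_power[of "i + 1"] by (simp add: monomial.simps flip: mult.assoc)
  then show ?thesis using normalizable_XY_base[OF rel_XY] by (simp only:)
qed

lemma normalizable_Y_base: "normalizable (gY * monomial (0, i, j))"
proof (cases "i \<le> 0")
  case True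
  then have "gY * monomial (0, i, j) = monomial (0, i - 1, j)"
    by (simp add: monomial.simps flip: mult.assoc Y_xy_power)
  then show ?thesis by (simp only: normalizable_monomial)
next
  case False
  then have "monomial (0, i, j) = gX * monomial (0, i - 1, j)"
    using X_xy_power[of "i - 1"] by (simp add: monomial.simps flip: mult.assoc)
  then show ?thesis using normalizable_XY_base[OF rel_YX] by (simp only:)
qed

text \<open>Moving \<open>X\<close>, \<open>Y\<close> or \<open>Z\<close> to the right of one factor \<open>\<theta>\<close> leaves a remainder without that factor, in
which other generators occur: \<open>Z \<theta>\<close> produces \<open>X\<close> and \<open>Y\<close>, while \<open>X \<theta>\<close> and \<open>Y \<theta>\<close> produce \<open>Z\<close>. The
induction on the exponent of \<open>\<theta>\<close> therefore treats the three generators together.\<close>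

lemma normalizable_XYZ_monomial:
  "normalizable (gX * monomial (k, i, j)) \<and> normalizable (gY * monomial (k, i, j))
    \<and> normalizable (gZ * monomial (k, i, j))"
proof (induction k)
  case 0
  show ?case by (intro conjI normalizable_X_base normalizable_Y_base normalizable_Z_base)
next
  case (Suc k)
  let ?m = "monomial (k, i, j)"
  have eq: "monomial (Suc k, i, j) = g\<theta> * ?m" by (simp add: monomial.simps mult.assoc)
  have red: "normalizable (g\<theta> * (gX * ?m))" "normalizable (g\<theta> * (gY * ?m))" "normalizable (g\<theta> * (gZ * ?m))"
    "normalizable (gX * ?m)" "normalizable (gY * ?m)" "normalizable (gZ * ?m)"
    using Suc normalizable_theta by auto
  have "gX * (g\<theta> * ?m) \<asymp> scalar (inverse q) *
      (scalar (inverse q) * (g\<theta> * (gX * ?m)) + scalar (q + inverse q) * (gZ * ?m))"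
    using cong_mult_right[OF rel_XT, of ?m] by (simp only: mult.assoc distrib_right)
  then have redX: "normalizable (gX * (g\<theta> * ?m))"
    by (rule normalizable_cong) (intro normalizable_add normalizable_scalar red)
  have "gY * (g\<theta> * ?m) \<asymp>
      scalar q * (scalar q * (g\<theta> * (gY * ?m)) - scalar (q + inverse q) * (gZ * ?m))"
    using cong_mult_right[OF rel_YT, of ?m] by (simp only: mult.assoc left_diff_distrib)
  then have redY: "normalizable (gY * (g\<theta> * ?m))"
    by (rule normalizable_cong) (intro normalizable_diff normalizable_scalar red)
  have "gZ * (g\<theta> * ?m) \<asymp> g\<theta> * (gZ * ?m) - gY * ?m + gX * ?m"
    using cong_mult_right[OF rel_ZT, of ?m] by (simp only: mult.assoc left_diff_distrib distrib_right)
  then have redZ: "normalizable (gZ * (g\<theta> * ?m))"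
    by (rule normalizable_cong) (intro normalizable_add normalizable_diff red)
  with redX redY show ?case by (simp only: eq)
qed

lemma normalizable_generator: "normalizable a \<Longrightarrow> normalizable (generator g * a)"
proof -
  assume a: "normalizable a"
  have "normalizable (gX * monomial t)" "normalizable (gY * monomial t)" "normalizable (gZ * monomial t)" for t
    using normalizable_XYZ_monomial by (cases t; simp)+
  with a show ?thesis by (cases g) (simp_all add: normalizable_theta normalizable_mult_left)
qed

lemma normalizable_all: "normalizable a"
proof (induction a rule: poly_mapping_induct_single)
  case zero
  show ?case by (rule normalizable_zero)
next
  case (add w c f)
  have "normalizable (Poly_Mapping.single (Word gs) 1)" for gs
  proof (induction gs)
    case Nil
    have "Poly_Mapping.single (Word []) 1 = monomial (0, 0, 0)"
      by (simp add: xy_power_def monomial.simps zero_word_def[symmetric])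
    then show ?case by (simp only: normalizable_monomial)
  next
    case (Cons g gs)
    have "Poly_Mapping.single (Word (g # gs)) (1 :: 'k) = generator g * Poly_Mapping.single (Word gs) 1"
      by (simp add: generator_def mult_single plus_word_def)
    then show ?case using normalizable_generator[OF Cons, of g] by simp
  qed
  from this[of "letters w"] have "normalizable (scalar c * Poly_Mapping.single w 1)"
    by (simp add: normalizable_scalar)
  then show ?case using add by (simp add: scalar_def mult_single normalizable_add)
qed

section \<open>Faithfulness\<close>

lemma act_state_smult: "act a (\<lambda>n. smult c (v n)) = (\<lambda>n. smult c (act a v n))"
  using act_state_mult[of a "[:c:]" v] by simp

definition basis_state :: "int \<Rightarrow> 'k state"
  where "basis_state n m = (if m = n then 1 else 0)"

lemma act_X_power: "act (gX ^ k) (basis_state n) = basis_state (n + int k)"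
proof (induction k)
  case 0
  show ?case by (simp add: act_one)
next
  case (Suc k)
  have "act (gX ^ Suc k) (basis_state n) = act gX (basis_state (n + int k))"
    by (simp add: act_mult Suc)
  also have "\<dots> = basis_state (n + int (Suc k))"
    by (auto simp: act_generator basis_state_def fun_eq_iff)
  finally show ?case .
qed

lemma act_Y_basis: "act gY (basis_state n) = (\<lambda>m. smult (lowering n) (basis_state (n - 1) m))"
  by (auto simp: act_generator basis_state_def fun_eq_iff)

lemma act_Y_power:
  "\<exists>r. r \<noteq> 0 \<and> act (gY ^ k) (basis_state n) = (\<lambda>m. smult r (basis_state (n - int k) m))"
proof (induction k)
  case 0
  show ?case by (intro exI[of _ 1]) (simp add: act_one)
next
  case (Suc k)
  then obtain r where r: "r \<noteq> 0"
    "act (gY ^ k) (basis_state n) = (\<lambda>m. smult r (basis_state (n - int k) m))"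
    by blast
  have "act (gY ^ Suc k) (basis_state n) = (\<lambda>m. smult r (act gY (basis_state (n - int k)) m))"
    by (simp add: act_mult r act_state_smult)
  also have "\<dots> = (\<lambda>m. smult (r * lowering (n - int k)) (basis_state (n - int (Suc k)) m))"
    by (simp add: act_Y_basis algebra_simps)
  finally show ?case using r(1) lowering_nonzero by (intro exI conjI) auto
qed

lemma act_xy_power:
  "\<exists>r. r \<noteq> 0 \<and> act (xy_power i) (basis_state n) = (\<lambda>m. smult r (basis_state (n + i) m))"
proof (cases "i \<ge> 0")
  case True
  then show ?thesis
    by (intro exI[of _ 1]) (simp add: xy_power_def act_X_power)
next
  case False
  then show ?thesis
    using act_Y_power[of "nat (- i)" n] by (simp add: xy_power_def)
qed

lemma act_Z_power: "act (gZ ^ j) v m = smult (weight m ^ j) (v m)"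
  by (induction j) (simp_all add: act_one act_mult act_generator)

lemma act_Z_power_basis:
  "act (gZ ^ j) (basis_state n) = (\<lambda>m. smult (weight n ^ j) (basis_state n m))"
  by (auto simp: act_Z_power basis_state_def fun_eq_iff)

text \<open>One factor \<open>\<theta>\<close> raises the degree in \<open>\<omega>\<close> by one, only through its term with \<open>\<omega>\<close>. That term does not
move positions, so the leading coefficients at different positions do not mix.\<close>

lemma act_theta_power:
  assumes "\<And>m. degree (v m) \<le> d"
  shows "degree (act (g\<theta> ^ k) v m) \<le> d + k
    \<and> Polynomial.coeff (act (g\<theta> ^ k) v m) (d + k) = (theta_scale / weight m) ^ k * Polynomial.coeff (v m) d"
proof (induction k arbitrary: m)
  case 0
  show ?case by (simp add: act_one assms)
next
  case (Suc k)
  let ?u = "act (g\<theta> ^ k) v"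
  have eq: "act (g\<theta> ^ Suc k) v = gen_act Theta_gen ?u"
    by (simp add: act_mult act_generator)
  have deg: "degree (?u m) < Suc (d + k)" for m using Suc[of m] by simp
  have "degree (pCons 0 (smult (inverse (weight m)) (?u m))) \<le> Suc (d + k)"
    using Suc[of m] by (auto simp: degree_pCons_eq_if)
  then have "degree (gen_act Theta_gen ?u m) \<le> Suc (d + k)"
    using less_imp_le[OF deg] by (auto intro!: degree_diff_le)
  moreover have "Polynomial.coeff (gen_act Theta_gen ?u m) (Suc (d + k))
      = (theta_scale / weight m) ^ Suc k * Polynomial.coeff (v m) d"
    using Suc[of m] deg by (simp add: coeff_eq_0 field_simps)
  ultimately show ?case unfolding eq by simp
qed

text \<open>The factor \<open>r n\<close> is the same for all \<open>j\<close>, so that a sum over \<open>j\<close> of leading coefficients is a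
polynomial in \<open>weight n\<close>.\<close>

lemma act_monomial_basis:
  obtains r where "\<And>n. r n \<noteq> 0"
    and "\<And>k j n m. k \<le> K \<Longrightarrow> Polynomial.coeff (act (monomial (k, i, j)) (basis_state n) m) K
      = (if k = K \<and> m = n + i then r n * weight n ^ j else 0)"
proof -
  obtain s where s: "\<And>n. s n \<noteq> 0"
    "\<And>n. act (xy_power i) (basis_state n) = (\<lambda>m. smult (s n) (basis_state (n + i) m))"
    using act_xy_power[of i] by metis
  define r where "r n = (theta_scale / weight (n + i)) ^ K * s n" for n
  have "r n \<noteq> 0" for n
    by (simp add: r_def s(1) theta_scale_nonzero)
  moreover have "Polynomial.coeff (act (monomial (k, i, j)) (basis_state n) m) K
      = (if k = K \<and> m = n + i then r n * weight n ^ j else 0)" if "k \<le> K" for k j n m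
  proof -
    define v where "v = (\<lambda>m. smult (weight n ^ j * s n) (basis_state (n + i) m))"
    have "act (monomial (k, i, j)) (basis_state n) = act (g\<theta> ^ k) v"
      by (simp add: monomial.simps act_mult act_Z_power_basis act_state_smult s(2) v_def)
    moreover have "degree (v m) \<le> 0" for m
      by (simp add: v_def basis_state_def)
    note top = act_theta_power[of v 0 k m, OF this]
    have "Polynomial.coeff (act (g\<theta> ^ k) v m) K
      = (if k = K \<and> m = n + i then r n * weight n ^ j else 0)"
    proof (cases "k = K")
      case True
      then show ?thesis using top by (simp add: r_def v_def basis_state_def)
    next
      case False
      then show ?thesis using top that by (simp add: coeff_eq_0)
    qed
    ultimately show ?thesis by simp
  qed
  ultimately show ?thesis using that by blast
qed

lemma infinite_range_weight: "infinite (range weight)"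
  using inj_weight by (simp add: finite_image_iff infinite_UNIV_int)

text \<open>The representation separates the elements of the quotient algebra: a combination of monomials that
acts as zero has only zero coefficients, and every element is congruent to such a combination.\<close>

lemma act_faithful:
  assumes "\<And>n m. act a (basis_state n) m = 0"
  shows "a \<in> rel_ideal q"
proof -
  obtain f where f: "a \<asymp> combination f"
    using normalizable_all[of a] unfolding normalizable_def ..
  have zero: "act (combination f) (basis_state n) m = 0" for n m
    using act_cong[OF f, of "basis_state n"] assms by metis
  have "f = 0"
  proof (rule ccontr)
    assume "f \<noteq> 0"
    let ?S = "Poly_Mapping.keys f"
    define K where "K = Max (fst ` ?S)"
    have "?S \<noteq> {}" using \<open>f \<noteq> 0\<close> by simp
    then have "K \<in> fst ` ?S" unfolding K_def by (intro Max_in) auto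
    then obtain i j where key: "(K, i, j) \<in> ?S" by force
    have K: "fst t \<le> K" if "t \<in> ?S" for t
      using that by (simp add: K_def)
    \<comment> \<open>The monomials with the largest exponent of \<open>\<theta>\<close> and the displacement \<open>i\<close>, as a polynomial in \<open>Z\<close>.\<close>
    define p where "p = (\<Sum>t\<in>?S. if fst t = K \<and> fst (snd t) = i
      then Polynomial.monom (Poly_Mapping.lookup f t) (snd (snd t)) else 0)"
    obtain r where r: "\<And>n. r n \<noteq> 0" and r_top:
      "\<And>k j n. k \<le> K \<Longrightarrow> Polynomial.coeff (act (monomial (k, i, j)) (basis_state n) (n + i)) K
        = (if k = K then r n * weight n ^ j else 0)"
      by (rule act_monomial_basis[of K i]) auto
    have top: "Polynomial.coeff (act (monomial t) (basis_state n) (n + i)) K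
        = (if fst t = K \<and> fst (snd t) = i then r n * weight n ^ snd (snd t) else 0)"
      if "t \<in> ?S" for t n
    proof -
      obtain k i' j' where t: "t = (k, i', j')" by (cases t)
      have k: "k \<le> K" using K[OF that] t by simp
      show ?thesis
      proof (cases "i' = i")
        case True
        then show ?thesis using r_top[OF k] by (simp add: t)
      next
        case False
        show ?thesis
          by (rule act_monomial_basis[of K i']) (simp add: t k False not_sym[OF False])
      qed
    qed
    have "poly p (weight n) = 0" for n
    proof -
      have "r n * poly p (weight n) = Polynomial.coeff (act (combination f) (basis_state n) (n + i)) K"
        unfolding p_def combination_def poly_sum act_sum coeff_sum sum_distrib_left
        by (rule sum.cong) (auto simp: act_mult act_scalar top poly_monom)
      then show ?thesis using zero r[of n] by simp
    qed
    then have "range weight \<subseteq> {x. poly p x = 0}" by auto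
    then have "p = 0"
      using poly_roots_finite[of p] infinite_range_weight finite_subset by blast
    then have "0 = Polynomial.coeff p j" by simp
    also have "\<dots> = (\<Sum>t\<in>?S. if t = (K, i, j) then Poly_Mapping.lookup f t else 0)"
      unfolding p_def coeff_sum by (rule sum.cong) auto
    also have "\<dots> = Poly_Mapping.lookup f (K, i, j)"
      using key by simp
    finally show False using key by (simp add: in_keys_iff)
  qed
  with f show ?thesis by (simp add: combination_zero cong_def)
qed

definition omega :: "'k free_alg"
  where "omega = scalar q * gX + scalar (inverse q) * gY + scalar (q - inverse q) * g\<theta> * gZ"

lemma act_omega: "act omega v = (\<lambda>n. [:0, 1:] * v n)"
proof (rule ext, rule poly_eqI)
  fix n m
  have [simp]: "q \<noteq> 0" by (rule q_nonzero)
  have inv: "(q - inverse q) * theta_scale = 1"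
    using theta_scale_nonzero by (simp add: theta_scale_def)
  define u where "u = (\<lambda>n. pCons 0 (v n) - smult q (v (n - 1)) - smult (inverse q * lowering (n + 1)) (v (n + 1)))"
  have "act (scalar (q - inverse q) * g\<theta> * gZ) v n = smult ((q - inverse q) * theta_scale) (u n)"
    by (simp add: act_simps u_def smult_diff_right mult.assoc)
  also have "\<dots> = u n" by (simp only: inv smult_1_left)
  finally have "act (scalar (q - inverse q) * g\<theta> * gZ) v n = u n" .
  then show "Polynomial.coeff (act omega v n) m = Polynomial.coeff ([:0, 1:] * v n) m"
    by (simp add: omega_def act_simps u_def)
qed

text \<open>The commutators of \<open>\<Omega>\<close> act as zero, since an operator of the representation is linear over \<open>K[\<omega>]\<close>.\<close>

lemma omega_central: "omega * a \<asymp> a * omega"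
  unfolding cong_def
  by (rule act_faithful) (simp add: act_diff act_mult act_omega act_state_mult del: mult_pCons_left)

text \<open>Commuting with \<open>Z\<close> forces diagonal form because the eigenvalues \<open>weight n\<close> are distinct; commuting with
the translation \<open>X\<close> makes the diagonal constant.\<close>

lemma central_acts_by_scalar:
  assumes "\<And>x. u * x \<asymp> x * u"
  shows "\<exists>p. \<forall>n. act u (basis_state n) = (\<lambda>m. p * basis_state n m)"
proof -
  define w where "w n = act u (basis_state n)" for n
  have com: "act u (act x v) = act x (act u v)" for x v
    using act_cong[OF assms[of x], of v] by (simp add: act_mult)
  have diagonal: "w n m = 0" if "m \<noteq> n" for m n
  proof -
    have "act gZ (basis_state n) = (\<lambda>m. smult (weight n) (basis_state n m))"
      using act_Z_power_basis[of 1 n] by simp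
    then have "smult (weight n) (w n m) = smult (weight m) (w n m)"
      using com[of gZ "basis_state n", THEN fun_cong, of m]
      by (simp add: w_def act_state_smult act_generator)
    then have "smult (weight n - weight m) (w n m) = 0"
      by (simp add: smult_diff_left)
    moreover have "weight n \<noteq> weight m"
      using inj_weight that by (auto dest: injD)
    ultimately show ?thesis by simp
  qed
  have step: "w (n + 1) (n + 1) = w n n" for n
  proof -
    have "act gX (basis_state n) = basis_state (n + 1)"
      using act_X_power[of 1 n] by simp
    then show ?thesis
      using com[of gX "basis_state n", THEN fun_cong, of "n + 1"]
      by (simp add: w_def act_generator)
  qed
  have const: "w n n = w 0 0" for n
  proof (induction n rule: int_induct[of _ 0])
    case (step2 i)
    then show ?case using step[of "i - 1"] by simp
  qed (use step in auto)
  have "\<forall>n. w n = (\<lambda>m. w 0 0 * basis_state n m)"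
    using diagonal const by (auto simp: basis_state_def fun_eq_iff)
  then show ?thesis unfolding w_def by blast
qed

end

section \<open>The centre\<close>

lemma (in ring) subring_ring_center: "subring (ring_center R) R"
proof (rule subringI)
  fix a b assume "a \<in> ring_center R" "b \<in> ring_center R"
  then have ab: "a \<in> carrier R" "b \<in> carrier R"
    and com: "\<And>x. x \<in> carrier R \<Longrightarrow> a \<otimes> x = x \<otimes> a"
      "\<And>x. x \<in> carrier R \<Longrightarrow> b \<otimes> x = x \<otimes> b"
    by (auto simp: ring_center_def)
  have "a \<otimes> b \<otimes> x = x \<otimes> (a \<otimes> b)" if x: "x \<in> carrier R" for x
  proof -
    have "a \<otimes> b \<otimes> x = a \<otimes> (x \<otimes> b)" using ab x by (simp add: m_assoc com(2)[OF x])
    also have "\<dots> = a \<otimes> x \<otimes> b" using ab x by (simp add: m_assoc)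
    also have "\<dots> = x \<otimes> (a \<otimes> b)" using ab x by (simp add: m_assoc com(1)[OF x])
    finally show ?thesis .
  qed
  with ab show "a \<otimes> b \<in> ring_center R" by (simp add: ring_center_def)
  show "a \<oplus> b \<in> ring_center R"
    using ab by (simp add: ring_center_def l_distr r_distr com)
next
  fix a assume "a \<in> ring_center R"
  then show "\<ominus> a \<in> ring_center R" by (simp add: ring_center_def l_minus r_minus)
qed (auto simp: ring_center_def)

lemma Uq_ring: "ring (Uq q)"
  unfolding Uq_def by (rule ideal.quotient_is_ring[OF ideal_rel_ideal])

lemma Uq_class_hom: "Uq_class q \<in> ring_hom ring_of_type_algebra (Uq q)"
  using ideal.rcos_ring_hom[OF ideal_rel_ideal] by (simp add: Uq_def Uq_class_def[abs_def])

lemma Uq_class_simps: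
  fixes q :: "'k :: field"
  shows
  "Uq_class q a \<in> carrier (Uq q)"
  "Uq_class q a \<otimes>\<^bsub>Uq q\<^esub> Uq_class q b = Uq_class q (a * b)"
  "Uq_class q a \<oplus>\<^bsub>Uq q\<^esub> Uq_class q b = Uq_class q (a + b)"
  "\<one>\<^bsub>Uq q\<^esub> = Uq_class q 1"
  using ring_hom_closed[OF Uq_class_hom[of q]] ring_hom_mult[OF Uq_class_hom[of q]] ring_hom_add[OF Uq_class_hom[of q]]
    ring_hom_one[OF Uq_class_hom[of q]]
  by (simp_all add: ring_of_type_algebra_simps)

lemma Uq_zero:
  fixes q :: "'k :: field"
  shows "\<zero>\<^bsub>Uq q\<^esub> = Uq_class q 0"
  using ring_hom_zero[OF Uq_class_hom[of q] ring_ring_of_type_algebra Uq_ring]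
  by (simp add: ring_of_type_algebra_simps)

lemma carrier_Uq: "carrier (Uq q) = range (Uq_class q)"
  by (auto simp: Uq_def Uq_class_def FactRing_def A_RCOSETS_def' ring_of_type_algebra_simps(1))

lemma Uq_class_eq_iff: "Uq_class q a = Uq_class q b \<longleftrightarrow> a - b \<in> rel_ideal q"
  using ring.quotient_eq_iff_same_a_r_cos[OF ring_ring_of_type_algebra ideal_rel_ideal, of a b q]
  by (simp add: Uq_class_def ring_of_type_algebra_simps a_minus_def a_inv_ring_of_type_algebra)

context generic_parameter
begin

lemma ring_center_iff: "Uq_class q u \<in> ring_center (Uq q) \<longleftrightarrow> (\<forall>x. u * x \<asymp> x * u)"
  by (auto simp: ring_center_def carrier_Uq Uq_class_simps Uq_class_eq_iff cong_def)

lemma Omega_eq: "Omega q = Uq_class q omega"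
  by (simp add: Omega_def omega_def Let_def)

lemma unital_subalgebra_center: "unital_subalgebra (Uq q) (Uq_scalar q) (ring_center (Uq q))"
  unfolding unital_subalgebra_def
proof (intro conjI allI ballI)
  show sub: "subring (ring_center (Uq q)) (Uq q)"
    by (rule ring.subring_ring_center[OF Uq_ring])
  fix c v assume v: "v \<in> ring_center (Uq q)"
  have "Uq_scalar q c \<in> ring_center (Uq q)"
    unfolding Uq_scalar_def ring_center_iff by (simp add: scalar_commute[of c] cong_refl)
  then show "Uq_scalar q c \<otimes>\<^bsub>Uq q\<^esub> v \<in> ring_center (Uq q)"
    using v by (rule subringE(6)[OF sub])
qed

text \<open>The witness is \<open>p(\<Omega>)\<close>, built by the Horner scheme and characterized by the way it acts.\<close>

lemma polynomial_in_omega: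
  assumes "unital_subalgebra (Uq q) (Uq_scalar q) V" and "Omega q \<in> V"
  shows "\<exists>a. Uq_class q a \<in> V \<and> (\<forall>v. act a v = (\<lambda>n. p * v n))"
proof (induction p)
  have sub: "subring V (Uq q)" and scale: "\<And>c v. v \<in> V \<Longrightarrow> Uq_scalar q c \<otimes>\<^bsub>Uq q\<^esub> v \<in> V"
    using assms(1) by (auto simp: unital_subalgebra_def)
  {
    case 0
    show ?case using subringE(2)[OF sub]
      by (intro exI[of _ 0]) (simp add: Uq_zero act_zero fun_eq_iff)
  next
    case (pCons c p)
    then obtain a where a: "Uq_class q a \<in> V" "\<And>v. act a v = (\<lambda>n. p * v n)" by blast
    have "Uq_scalar q c \<in> V"
      using scale[OF subringE(3)[OF sub], of c] by (simp add: Uq_scalar_def Uq_class_simps)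
    then have "Uq_class q (scalar c + omega * a) \<in> V"
      using subringE(6)[OF sub assms(2) a(1)] subringE(7)[OF sub, of "Uq_scalar q c"]
      by (metis Omega_eq Uq_class_simps(2,3) Uq_scalar_def)
    moreover have "act (scalar c + omega * a) v = (\<lambda>n. pCons c p * v n)" for v
      by (simp add: fun_eq_iff act_add act_scalar act_mult act_omega a(2))
    ultimately show ?case by blast
  }
qed

lemma center_Uq: "ring_center (Uq q) = generated_subalgebra (Uq q) (Uq_scalar q) {Omega q}"
  unfolding generated_subalgebra_def
proof
  show "unital_subalgebra (Uq q) (Uq_scalar q) hull {Omega q} \<subseteq> ring_center (Uq q)"
    by (rule hull_minimal)
      (simp_all add: unital_subalgebra_center Omega_eq ring_center_iff omega_central)
  show "ring_center (Uq q) \<subseteq> unital_subalgebra (Uq q) (Uq_scalar q) hull {Omega q}"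
    unfolding hull_def
  proof (rule subsetI, rule InterI)
    fix z V assume z: "z \<in> ring_center (Uq q)"
      and "V \<in> {t. unital_subalgebra (Uq q) (Uq_scalar q) t \<and> {Omega q} \<subseteq> t}"
    then have V: "unital_subalgebra (Uq q) (Uq_scalar q) V" "{Omega q} \<subseteq> V" by auto
    obtain u where u: "z = Uq_class q u" using z by (auto simp: ring_center_def carrier_Uq)
    obtain p where p: "\<And>n. act u (basis_state n) = (\<lambda>m. p * basis_state n m)"
      using central_acts_by_scalar[of u] z unfolding u ring_center_iff by blast
    obtain a where a: "Uq_class q a \<in> V" "\<And>v. act a v = (\<lambda>n. p * v n)"
      using polynomial_in_omega[OF V(1), of p] V(2) by blast
    have "u - a \<in> rel_ideal q"
      by (rule act_faithful) (simp add: act_diff p a(2))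
    then show "z \<in> V" using a(1) by (simp add: u flip: Uq_class_eq_iff)
  qed
qed

end

theorem theorem3p3:
  fixes \<iota> :: "complex \<Rightarrow> 'k :: field" and \<sigma> :: "'k \<Rightarrow> 'k" and q :: 'k
  assumes "involutive_extension \<iota> \<sigma>"
    and "q \<noteq> 0"
    and "\<forall>n::nat. n > 0 \<longrightarrow> q ^ n \<noteq> 1"
    and "\<exists>s. s\<^sup>2 = q \<and> self_adjoint \<sigma> s"
  shows "ring_center (Uq q) = generated_subalgebra (Uq q) (Uq_scalar q) {Omega q}"
proof -
  interpret generic_parameter q
    using assms(2,3) by unfold_locales auto
  show ?thesis by (rule center_Uq)
qed

end
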